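(* For every $\gamma$ with $1<\gamma<3$ there exist a domain $\mathcal X$ and a class $\mathcal P=\{p_0,p_1\}$ of two distinct distributions on $\mathcal X$ which is not $\gamma$-robustly testable with respect to the symmetric $\chi^2$ distance.
   Context: Distributions. The domain $\mathcal X$ is either a discrete (countable) set, in which case a distribution on $\mathcal X$ means a probability mass function, or $\mathcal X=\mathbb R^d$, in which case a distribution means a probability density with respect to Lebesgue measure. Let $\Delta(\mathcal X)$ be the set of all such distributions. Integrals are read as sums in the discrete case. Symmetric $\chi^2$ distance: $\chi^2(p,q)=\left\|\frac{p-q}{\sqrt{p+q}}\right\|_2^2=\int_{\mathcal X}\frac{(p(x)-q(x))^2}{p(x)+q(x)}\,dx$, with the convention $0/0=0$. Robust testability. Let $\mathcal P=\{p_0,p_1\}$ with $p_0\neq p_1$ in $\Delta(\mathcal X)$ and let $\gamma>1$. For a target distribution $p\in\Delta(\mathcal X)$ consider the hypotheses $$H_0:\ \gamma\chi^2(p,p_0)\le\chi^2(p,p_1),\qquad H_1:\ \chi^2(p,p_0)\ge\gamma\chi^2(p,p_1).$$ A (possibly randomized) test is a family of measurable maps $T_m:\mathcal X^m\to[0,1]$, $m\ge1$, where $T_m(x_1,\dots,x_m)$ is the probability of outputting $p_1$ (otherwise $p_0$ is output) upon observing $x_1,\dots,x_m$. The class $\mathcal P$ is $\gamma$-robustly testable (with respect to the symmetric $\chi^2$ distance) if there is a test such that for every $\delta>0$ there is a finite $m(\delta)$ such that for every target distribution $p\in\Delta(\mathcal X)$ satisfying $H_0$ or $H_1$, and every $m\ge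 m(\delta)$, the test given $m$ i.i.d. samples from $p$ outputs the element $q$ of $\mathcal P$ minimizing $\chi^2(q,p)$ (that is, $p_0$ under $H_0$ and $p_1$ under $H_1$) with probability at least $1-\delta$. The bound $m(\delta)$ may depend on $\mathcal P$ and $\gamma$ but not on $p$. *)

theory Defs
  imports "HOL-Probability.Probability"
begin

text \<open>
  A domain is represented by its base measure: counting measure on a countable set, or Lebesgue
  measure on \<open>\<real>\<^sup>d\<close>, whose points are the extensional functions on \<open>{..<d}\<close>.  Points of both kinds
  live in the type \<open>nat \<Rightarrow> real\<close>, which makes it possible to quantify over all domains at once;
  every countable set is in bijection with a subset of this type.
\<close>

definition is_domain :: "(nat \<Rightarrow> real) measure \<Rightarrow> bool" where
  "is_domain \<mu> \<longleftrightarrow>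
     (\<exists>X. countable X \<and> \<mu> = count_space X) \<or>
     (\<exists>d\<ge>1. \<mu> = (\<Pi>\<^sub>M i\<in>{..<d}. lborel))"

definition distributions :: "'a measure \<Rightarrow> ('a \<Rightarrow> real) set" where
  "distributions \<mu> =
     {p \<in> borel_measurable \<mu>. (\<forall>x\<in>space \<mu>. 0 \<le> p x) \<and> (\<integral>\<^sup>+x. ennreal (p x) \<partial>\<mu>) = 1}"

text \<open>
  Two densities are the same distribution if they agree almost everywhere; for counting measure
  this is equality at every point of the domain.
\<close>

definition same_distribution :: "'a measure \<Rightarrow> ('a \<Rightarrow> real) \<Rightarrow> ('a \<Rightarrow> real) \<Rightarrow> bool" where
  "same_distribution \<mu> p q \<longleftrightarrow> (AE x in \<mu>. p x = q x)"

text \<open>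
  The convention \<open>0/0 = 0\<close> is that of division in HOL.  For distributions the integrand is bounded
  by \<open>p x + q x\<close>, so it is always integrable.
\<close>

definition chi2 :: "'a measure \<Rightarrow> ('a \<Rightarrow> real) \<Rightarrow> ('a \<Rightarrow> real) \<Rightarrow> real" where
  "chi2 \<mu> p q = (\<integral>x. (p x - q x)\<^sup>2 / (p x + q x) \<partial>\<mu>)"

definition iid :: "'a measure \<Rightarrow> ('a \<Rightarrow> real) \<Rightarrow> nat \<Rightarrow> (nat \<Rightarrow> 'a) measure" where
  "iid \<mu> p m = (\<Pi>\<^sub>M i\<in>{..<m}. density \<mu> (\<lambda>x. ennreal (p x)))"

text \<open>\<open>T m xs\<close> is the probability of outputting \<open>p\<^sub>1\<close> on the sample \<open>xs\<close> of size \<open>m\<close>.\<close>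

definition is_test :: "'a measure \<Rightarrow> (nat \<Rightarrow> (nat \<Rightarrow> 'a) \<Rightarrow> real) \<Rightarrow> bool" where
  "is_test \<mu> T \<longleftrightarrow>
     (\<forall>m\<ge>1. T m \<in> borel_measurable (\<Pi>\<^sub>M i\<in>{..<m}. \<mu>) \<and>
            (\<forall>xs\<in>space (\<Pi>\<^sub>M i\<in>{..<m}. \<mu>). 0 \<le> T m xs \<and> T m xs \<le> 1))"

definition robustly_testable ::
    "'a measure \<Rightarrow> real \<Rightarrow> ('a \<Rightarrow> real) \<Rightarrow> ('a \<Rightarrow> real) \<Rightarrow> bool" where
  "robustly_testable \<mu> \<gamma> p0 p1 \<longleftrightarrow>
     (\<exists>T. is_test \<mu> T \<and>
       (\<forall>\<delta>>0. \<exists>m0\<ge>1. \<forall>p\<in>distributions \<mu>. \<forall>m\<ge>m0.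
          (\<gamma> * chi2 \<mu> p p0 \<le> chi2 \<mu> p p1 \<longrightarrow>
             (\<integral>xs. 1 - T m xs \<partial>iid \<mu> p m) \<ge> 1 - \<delta>) \<and>
          (chi2 \<mu> p p0 \<ge> \<gamma> * chi2 \<mu> p p1 \<longrightarrow>
             (\<integral>xs. T m xs \<partial>iid \<mu> p m) \<ge> 1 - \<delta>)))"

end

theory Submission
  imports Defs
begin

text \<open>
  On the real line let \<open>p\<^sub>0\<close> and \<open>p\<^sub>1\<close> be uniform on disjoint unit intervals \<open>A\<close> and \<open>A'\<close>.  Spread
  mass \<open>1/2\<close> evenly over \<open>A\<close> and squeeze the other half onto a subset \<open>B\<close> of \<open>A'\<close> of measure
  \<open>1/K\<close>: the distances to \<open>p\<^sub>0\<close> and \<open>p\<^sub>1\<close> are \<open>2/3\<close> and \<open>2 - 4/(K+2)\<close>, whose ratio tends to 3.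
  If \<open>B\<close> is drawn from many pairwise independent candidates, the mixture of the \<open>m\<close>-fold products
  has \<open>\<chi>\<^sup>2\<close>-divergence at most \<open>K\<^sup>m/N\<close> from the \<open>m\<close>-fold product of the uniform distribution on
  \<open>A \<union> A'\<close>.  Exchanging \<open>A\<close> and \<open>A'\<close> yields targets of the other hypothesis near the same product,
  so no test serves both.
\<close>

section \<open>Products of densities and the second moment method\<close>

text \<open>Both measures agree on boxes, where the indicator and the density factor over the
  coordinates, and boxes determine a finite product measure. This expresses the law of an i.i.d.
  sample by its likelihood ratio against a reference product.\<close>

lemma PiM_density:
  fixes f :: "'a \<Rightarrow> real"
  assumes "finite I" and M: "prob_space M" and f [measurable]: "f \<in> borel_measurable M"
    and f0: "\<And>x. 0 \<le> f x" and D: "prob_space (density M (\<lambda>x. ennreal (f x)))"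
  shows "(\<Pi>\<^sub>M i\<in>I. density M (\<lambda>x. ennreal (f x))) =
         density (\<Pi>\<^sub>M i\<in>I. M) (\<lambda>x. ennreal (\<Prod>i\<in>I. f (x i)))"
proof -
  interpret M: prob_space M by fact
  interpret D: prob_space "density M (\<lambda>x. ennreal (f x))" by fact
  interpret PM: product_sigma_finite "\<lambda>i. M" by standard
  interpret PD: product_sigma_finite "\<lambda>i. density M (\<lambda>x. ennreal (f x))" by standard
  show ?thesis
  proof (rule PD.PiM_eqI[symmetric])
    show "finite I" by fact
    show "sets (density (Pi\<^sub>M I (\<lambda>i. M)) (\<lambda>x. ennreal (\<Prod>i\<in>I. f (x i)))) =
          sets (\<Pi>\<^sub>M i\<in>I. density M (\<lambda>x. ennreal (f x)))"
      by (simp cong: sets_PiM_cong)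
  next
    fix A assume "\<And>i. i \<in> I \<Longrightarrow> A i \<in> sets (density M (\<lambda>x. ennreal (f x)))"
    then have A [measurable]: "A i \<in> sets M" if "i \<in> I" for i using that by simp
    have PA: "Pi\<^sub>E I A \<in> sets (\<Pi>\<^sub>M i\<in>I. M)" using A \<open>finite I\<close> by (simp add: sets_PiM_I_finite)
    have "emeasure (density (Pi\<^sub>M I (\<lambda>i. M)) (\<lambda>x. ennreal (\<Prod>i\<in>I. f (x i)))) (Pi\<^sub>E I A) =
        (\<integral>\<^sup>+x. ennreal (\<Prod>i\<in>I. f (x i)) * indicator (Pi\<^sub>E I A) x \<partial>(\<Pi>\<^sub>M i\<in>I. M))"
      by (rule emeasure_density[OF _ PA]) measurable
    also have "\<dots> = (\<integral>\<^sup>+x. (\<Prod>i\<in>I. ennreal (f (x i)) * indicator (A i) (x i)) \<partial>(\<Pi>\<^sub>M i\<in>I. M))"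
    proof (rule nn_integral_cong)
      fix x assume x: "x \<in> space (\<Pi>\<^sub>M i\<in>I. M)"
      have "(\<Prod>i\<in>I. indicator (A i) (x i)) = (indicator (Pi\<^sub>E I A) x :: ennreal)"
      proof (cases "x \<in> Pi\<^sub>E I A")
        case False
        with x obtain i where "i \<in> I" "x i \<notin> A i" by (auto simp: space_PiM PiE_iff)
        then have "(\<Prod>i\<in>I. indicator (A i) (x i)) = (0::ennreal)"
          using \<open>finite I\<close> by (intro prod_zero bexI[of _ i]) auto
        with False show ?thesis by simp
      qed (auto intro!: prod.neutral simp: PiE_iff)
      then show "ennreal (\<Prod>i\<in>I. f (x i)) * indicator (Pi\<^sub>E I A) x =
          (\<Prod>i\<in>I. ennreal (f (x i)) * indicator (A i) (x i))"
        by (simp add: prod.distrib prod_ennreal f0)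
    qed
    also have "\<dots> = (\<Prod>i\<in>I. \<integral>\<^sup>+x. ennreal (f x) * indicator (A i) x \<partial>M)"
      by (intro PM.product_nn_integral_prod \<open>finite I\<close>) measurable
    also have "\<dots> = (\<Prod>i\<in>I. emeasure (density M (\<lambda>x. ennreal (f x))) (A i))"
      by (intro prod.cong refl) (simp add: emeasure_density)
    finally show "emeasure (density (Pi\<^sub>M I (\<lambda>i. M)) (\<lambda>x. ennreal (\<Prod>i\<in>I. f (x i)))) (Pi\<^sub>E I A) =
      (\<Prod>i\<in>I. emeasure (density M (\<lambda>x. ennreal (f x))) (A i))" .
  qed
qed

text \<open>Second moment method: the averaged likelihood ratio of the \<open>N\<close> product laws
  has mean 1 under the reference product, and its variance is at most \<open>c ^ m / N\<close>,
  because distinct \<open>L n\<close> are uncorrelated and only the \<open>N\<close> diagonal pairs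
  contribute. The mean of \<open>\<phi>\<close> under the reference therefore falls short of its
  average over the product laws by at most \<open>\<epsilon>\<close>.\<close>

lemma test_against_product_mixture:
  fixes L :: "nat \<Rightarrow> 'a \<Rightarrow> real" and \<phi> :: "(nat \<Rightarrow> 'a) \<Rightarrow> real" and \<epsilon> :: real
  assumes G: "prob_space G" and L [measurable]: "\<And>n. n < N \<Longrightarrow> L n \<in> borel_measurable G"
    and L_bounds: "\<And>n x. 0 \<le> L n x" "\<And>n x. L n x \<le> c"
    and L_mean: "\<And>n. n < N \<Longrightarrow> (\<integral>x. L n x \<partial>G) = 1"
    and L_orth: "\<And>n k. n < N \<Longrightarrow> k < N \<Longrightarrow> n \<noteq> k \<Longrightarrow> (\<integral>x. L n x * L k x \<partial>G) = 1"
    and L_sq: "\<And>n. n < N \<Longrightarrow> (\<integral>x. L n x * L n x \<partial>G) \<le> c"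
    and \<phi> [measurable]: "\<phi> \<in> borel_measurable (\<Pi>\<^sub>M i\<in>{..<m}. G)"
    and \<phi>_bounds: "\<And>x. x \<in> space (\<Pi>\<^sub>M i\<in>{..<m}. G) \<Longrightarrow> 0 \<le> \<phi> x \<and> \<phi> x \<le> 1"
    and \<epsilon>: "0 < \<epsilon>" and N: "c ^ m \<le> \<epsilon>\<^sup>2 * N" "0 < N"
    and test: "\<And>n. n < N \<Longrightarrow> b \<le> (\<integral>x. \<phi> x \<partial>(\<Pi>\<^sub>M i\<in>{..<m}. density G (\<lambda>x. ennreal (L n x))))"
  shows "b - \<epsilon> \<le> (\<integral>x. \<phi> x \<partial>(\<Pi>\<^sub>M i\<in>{..<m}. G))"
proof -
  interpret G: prob_space G by fact
  interpret P: product_sigma_finite "\<lambda>i. G" by standard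
  let ?G = "\<Pi>\<^sub>M i\<in>{..<m}. G"
  interpret GG: prob_space ?G by (intro prob_space_PiM G)
  \<comment> \<open>Likelihood ratio of the whole sample; independence of the coordinates turns its
    moments into \<open>m\<close>-th powers of the moments of \<open>L n\<close>.\<close>
  define R where "R n x = (\<Prod>i<m. L n (x i))" for n and x :: "nat \<Rightarrow> 'a"
  have R [measurable]: "R n \<in> borel_measurable ?G" if "n < N" for n
    unfolding R_def using L[OF that] by measurable
  have c0: "0 \<le> c" using L_bounds[of 0 undefined] by linarith
  have R0: "0 \<le> R n x" for n x unfolding R_def by (intro prod_nonneg) (simp add: L_bounds)
  have Rc: "R n x \<le> c ^ m" for n x
    using prod_mono[of "{..<m}" "\<lambda>i. L n (x i)" "\<lambda>_. c"] L_bounds by (simp add: R_def)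
  have int_L: "integrable G (L n)" if "n < N" for n
    using that L_bounds by (intro G.integrable_const_bound[where B = c]) auto
  have int_LL: "integrable G (\<lambda>x. L n x * L k x)" if "n < N" "k < N" for n k
    using that L_bounds c0
    by (intro G.integrable_const_bound[where B = "c * c"]) (auto intro!: mult_mono simp: abs_mult)
  have int_R: "integrable ?G (R n)" if "n < N" for n
    using that R0 Rc by (intro GG.integrable_const_bound[where B = "c ^ m"]) auto
  have int_RR: "integrable ?G (\<lambda>x. R n x * R k x)" if "n < N" "k < N" for n k
    using that R0 Rc c0
    by (intro GG.integrable_const_bound[where B = "c ^ m * c ^ m"]) (auto intro!: mult_mono simp: abs_mult)
  have int_\<phi>: "integrable ?G \<phi>"
    using \<phi>_bounds by (intro GG.integrable_const_bound[where B = 1]) auto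
  have int_R\<phi>: "integrable ?G (\<lambda>x. R n x * \<phi> x)" if "n < N" for n
    using that R0 Rc c0 \<phi>_bounds
    by (intro GG.integrable_const_bound[where B = "c ^ m * 1"])
       (auto intro!: mult_mono simp: abs_mult simp del: mult_1_right)
  have E_R: "(\<integral>x. R n x \<partial>?G) = 1" if "n < N" for n
    unfolding R_def using P.product_integral_prod[of "{..<m}" "\<lambda>_. L n"] int_L[OF that] L_mean[OF that]
    by simp
  have E_RR: "(\<integral>x. R n x * R k x \<partial>?G) = (\<integral>x. L n x * L k x \<partial>G) ^ m" if "n < N" "k < N" for n k
    unfolding R_def prod.distrib[symmetric]
    using P.product_integral_prod[of "{..<m}" "\<lambda>_ x. L n x * L k x"] int_LL[OF that] by simp
  have test': "b \<le> (\<integral>x. R n x * \<phi> x \<partial>?G)" if n: "n < N" for n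
  proof -
    have "prob_space (density G (\<lambda>x. ennreal (L n x)))"
    proof (rule prob_spaceI)
      have "emeasure (density G (\<lambda>x. ennreal (L n x))) (space G) = (\<integral>\<^sup>+x. ennreal (L n x) \<partial>G)"
        using n by (auto simp: emeasure_density intro!: nn_integral_cong)
      then show "emeasure (density G (\<lambda>x. ennreal (L n x))) (space (density G (\<lambda>x. ennreal (L n x)))) = 1"
        using int_L[OF n] L_mean[OF n] L_bounds by (simp add: nn_integral_eq_integral)
    qed
    then have "(\<Pi>\<^sub>M i\<in>{..<m}. density G (\<lambda>x. ennreal (L n x))) = density ?G (\<lambda>x. ennreal (R n x))"
      unfolding R_def using n L_bounds by (intro PiM_density G) auto
    then show ?thesis
      using test[OF n] n R0 by (simp add: integral_density)
  qed
  \<comment> \<open>\<open>D\<close> is the centred density of the uniform mixture of the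
    \<open>N\<close> product laws with respect to \<open>?G\<close>.\<close>
  define D where "D x = (\<Sum>n<N. R n x) / N - 1" for x
  define S1 where "S1 x = (\<Sum>n<N. R n x)" for x
  define S2 where "S2 x = (\<Sum>n<N. \<Sum>k<N. R n x * R k x)" for x
  have int_S1: "integrable ?G S1" and E_S1: "(\<integral>x. S1 x \<partial>?G) = N"
    unfolding S1_def using int_R E_R by (auto intro!: Bochner_Integration.integrable_sum)
  have int_S2: "integrable ?G S2"
    unfolding S2_def using int_RR by (auto intro!: Bochner_Integration.integrable_sum)
  have "(\<integral>x. S2 x \<partial>?G) = (\<Sum>n<N. \<integral>x. (\<Sum>k<N. R n x * R k x) \<partial>?G)"
    unfolding S2_def
    by (intro Bochner_Integration.integral_sum Bochner_Integration.integrable_sum int_RR) auto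
  also have "\<dots> = (\<Sum>n<N. \<Sum>k<N. \<integral>x. R n x * R k x \<partial>?G)"
    by (intro sum.cong refl Bochner_Integration.integral_sum int_RR) auto
  finally have E_S2: "(\<integral>x. S2 x \<partial>?G) = (\<Sum>n<N. \<Sum>k<N. (\<integral>x. L n x * L k x \<partial>G) ^ m)"
    by (simp add: E_RR)
  have D2: "(D x)\<^sup>2 = S2 x / N\<^sup>2 - 2 * (S1 x / N) + 1" for x
    by (simp add: D_def S1_def S2_def power2_diff power_divide flip: sum_product power2_eq_square)
  have int_D2: "integrable ?G (\<lambda>x. (D x)\<^sup>2)" unfolding D2 using int_S1 int_S2 by simp
  have "(\<integral>x. (D x)\<^sup>2 \<partial>?G) =
      (\<Sum>n<N. \<Sum>k<N. (\<integral>x. L n x * L k x \<partial>G) ^ m) / N\<^sup>2 - 1"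
    unfolding D2 using int_S1 int_S2 E_S1 E_S2 N by (simp add: GG.prob_space)
  \<comment> \<open>Off the diagonal each term is a power of 1. On the diagonal \<open>c ^ m\<close>
    is weakened to \<open>1 + c ^ m\<close>, so that the ones add up to the square of
    \<open>N\<close> and cancel the \<open>- 1\<close> exactly.\<close>
  also have "(\<Sum>n<N. \<Sum>k<N. (\<integral>x. L n x * L k x \<partial>G) ^ m) \<le>
      (\<Sum>n<N. \<Sum>k<N. 1 + (if n = k then c ^ m else 0))"
    using L_sq L_orth L_bounds
    by (intro sum_mono) (auto intro!: add_increasing power_mono integral_nonneg)
  also have "\<dots> = N\<^sup>2 + N * c ^ m"
    by (simp add: sum.distrib power2_eq_square distrib_left)
  also have "(real (N\<^sup>2) + N * c ^ m) / N\<^sup>2 - 1 = c ^ m / N"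
    using N by (simp add: field_simps power2_eq_square)
  also have "\<dots> \<le> \<epsilon>\<^sup>2" using N by (simp add: field_simps)
  finally have E_D2: "(\<integral>x. (D x)\<^sup>2 \<partial>?G) \<le> \<epsilon>\<^sup>2"
    by (simp add: divide_right_mono)
  have "real N * b \<le> (\<Sum>n<N. \<integral>x. R n x * \<phi> x \<partial>?G)"
    using sum_mono[of "{..<N}" "\<lambda>_. b"] test' by simp
  then have "b \<le> (\<Sum>n<N. \<integral>x. R n x * \<phi> x \<partial>?G) / N"
    using N by (simp add: field_simps)
  also have "\<dots> = (\<integral>x. (\<Sum>n<N. R n x * \<phi> x) / N \<partial>?G)"
    using int_R\<phi> by simp
  also have "\<dots> \<le> (\<integral>x. \<phi> x + ((D x)\<^sup>2 / (2 * \<epsilon>) + \<epsilon> / 2) \<partial>?G)"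
  proof (rule integral_mono)
    show "integrable ?G (\<lambda>x. (\<Sum>n<N. R n x * \<phi> x) / N)"
      using int_R\<phi> by (intro integrable_divide_zero Bochner_Integration.integrable_sum) auto
    show "integrable ?G (\<lambda>x. \<phi> x + ((D x)\<^sup>2 / (2 * \<epsilon>) + \<epsilon> / 2))" using int_\<phi> int_D2 by auto
    fix x assume x: "x \<in> space ?G"
    \<comment> \<open>A pointwise arithmetic-geometric mean inequality takes the place of
      Cauchy-Schwarz; weighted by \<open>\<epsilon>\<close>, its two summands integrate to at most
      \<open>\<epsilon> / 2\<close> each.\<close>
    have "0 \<le> (\<bar>D x\<bar> - \<epsilon>)\<^sup>2" by simp
    then have "\<bar>D x\<bar> \<le> (D x)\<^sup>2 / (2 * \<epsilon>) + \<epsilon> / 2"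
      using \<epsilon> by (simp add: power2_diff field_simps power2_eq_square)
    moreover have "D x * \<phi> x \<le> \<bar>D x\<bar>"
      using \<phi>_bounds[OF x] mult_mono[of "D x" "\<bar>D x\<bar>" "\<phi> x" 1] by simp
    moreover have "(\<Sum>n<N. R n x * \<phi> x) / N = \<phi> x + D x * \<phi> x"
      unfolding D_def sum_distrib_right[symmetric] by (simp add: algebra_simps)
    ultimately show "(\<Sum>n<N. R n x * \<phi> x) / N \<le> \<phi> x + ((D x)\<^sup>2 / (2 * \<epsilon>) + \<epsilon> / 2)" by linarith
  qed
  also have "\<dots> = (\<integral>x. \<phi> x \<partial>?G) + ((\<integral>x. (D x)\<^sup>2 \<partial>?G) / (2 * \<epsilon>) + \<epsilon> / 2)"
    using int_\<phi> int_D2 by (simp add: GG.prob_space)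
  also have "\<dots> \<le> (\<integral>x. \<phi> x \<partial>?G) + (\<epsilon>\<^sup>2 / (2 * \<epsilon>) + \<epsilon> / 2)"
    using E_D2 \<epsilon> by (intro add_mono divide_right_mono) auto
  also have "\<epsilon>\<^sup>2 / (2 * \<epsilon>) + \<epsilon> / 2 = \<epsilon>" using \<epsilon> by (simp add: power2_eq_square)
  finally show ?thesis by simp
qed

section \<open>Pairwise independent subsets of an interval\<close>

text \<open>Coordinates in \<open>J\<close> are forced and the others are free. For a uniformly
  random function the events \<open>f j = 0\<close> are thus independent of probability
  \<open>1 / K\<close>; the multiplicative form avoids subtraction in the exponent.\<close>

lemma card_PiE_vanishing:
  fixes K N :: nat
  assumes "J \<subseteq> {..<N}" "0 < K"
  shows "card {f \<in> {..<N} \<rightarrow>\<^sub>E {..<K}. \<forall>j\<in>J. f j = 0} * K ^ card J = K ^ N"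
proof -
  have fin: "finite J" using assms(1) finite_subset by blast
  have "{f \<in> {..<N} \<rightarrow>\<^sub>E {..<K}. \<forall>j\<in>J. f j = 0} = (\<Pi>\<^sub>E i\<in>{..<N}. if i \<in> J then {0} else {..<K})"
    using assms by (auto simp: PiE_iff extensional_def split: if_splits)
  then have "card {f \<in> {..<N} \<rightarrow>\<^sub>E {..<K}. \<forall>j\<in>J. f j = 0} = (\<Prod>i<N. if i \<in> J then 1 else K)"
    by (auto simp: card_PiE intro!: prod.cong)
  also have "\<dots> = K ^ card ({..<N} - J)"
    by (simp add: prod.If_cases Diff_eq)
  also have "\<dots> * K ^ card J = K ^ N"
    using assms fin card_mono[OF _ assms(1)] by (simp add: card_Diff_subset flip: power_add)
  finally show ?thesis .
qed

text \<open>Cut the interval into \<open>K ^ N\<close> equal cells labelled by the functions from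
  \<open>{..<N}\<close> to \<open>{..<K}\<close>, and let \<open>B n\<close> be the union of the
  cells whose label vanishes at \<open>n\<close>. Lebesgue measure on the interval then copies the
  uniform distribution on labels.\<close>

lemma pairwise_independent_subsets_unit_interval:
  fixes a :: real and K N :: nat
  assumes K: "0 < K"
  obtains B :: "nat \<Rightarrow> real set"
  where "\<And>n. n < N \<Longrightarrow> B n \<in> sets borel" "\<And>n. n < N \<Longrightarrow> B n \<subseteq> {a..<a + 1}"
    "\<And>n. n < N \<Longrightarrow> measure lborel (B n) = 1 / K"
    "\<And>n k. n < N \<Longrightarrow> k < N \<Longrightarrow> n \<noteq> k \<Longrightarrow> measure lborel (B n \<inter> B k) = 1 / K\<^sup>2"
proof -
  define Q where "Q = K ^ N"
  have Q: "0 < Q" using K by (simp add: Q_def)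
  define cell where "cell c = {a + real c / Q..<a + real (Suc c) / Q}" for c
  define U where "U I = (\<Union>c\<in>I. cell c)" for I
  \<comment> \<open>A point of a cell determines the index of the cell, which gives
    disjointness.\<close>
  have cell_floor: "c = nat \<lfloor>(x - a) * Q\<rfloor>" if "x \<in> cell c" for c x
  proof -
    have "real c \<le> (x - a) * Q \<and> (x - a) * Q < real c + 1"
      using that Q by (auto simp: cell_def field_simps)
    then show ?thesis by linarith
  qed
  have cell_disj: "c = d" if "x \<in> cell c" "x \<in> cell d" for c d x
    using cell_floor that by blast
  have U_Int: "U I \<inter> U J = U (I \<inter> J)" for I J
  proof (intro equalityI subsetI)
    fix x assume "x \<in> U I \<inter> U J"
    then obtain c d where "c \<in> I" "x \<in> cell c" "d \<in> J" "x \<in> cell d" by (auto simp: U_def)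
    moreover from this have "c = d" using cell_disj by blast
    ultimately show "x \<in> U (I \<inter> J)" unfolding U_def by blast
  qed (auto simp: U_def)
  have U_sub: "U I \<subseteq> {a..<a + 1}" if "I \<subseteq> {..<Q}" for I
  proof
    fix x assume "x \<in> U I"
    then obtain c where c: "c \<in> I" "x \<in> cell c" by (auto simp: U_def)
    then have "Suc c \<le> Q" using that by auto
    then have "real (Suc c) / Q \<le> 1" using Q by (simp add: field_simps)
    moreover have "0 \<le> real c / Q" by simp
    ultimately show "x \<in> {a..<a + 1}" using c(2) by (simp only: cell_def atLeastLessThan_iff) linarith
  qed
  have U_sets: "U I \<in> sets borel" if "I \<subseteq> {..<Q}" for I
    unfolding U_def cell_def using that finite_subset by (intro sets.finite_UN) auto
  have cell_measure: "measure lborel (cell c) = 1 / Q" for c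
  proof -
    have "real c / Q \<le> real (Suc c) / Q" by (intro divide_right_mono) auto
    moreover have "real (Suc c) / Q - real c / Q = 1 / Q" by (simp add: diff_divide_distrib[symmetric])
    ultimately show ?thesis by (simp add: cell_def)
  qed
  have U_measure: "measure lborel (U I) = card I / Q" if "I \<subseteq> {..<Q}" for I
  proof -
    have "measure lborel (U I) = (\<Sum>c\<in>I. measure lborel (cell c))"
      unfolding U_def
    proof (rule measure_finite_Union)
      show "finite I" using that finite_subset by blast
      show "disjoint_family_on cell I" using cell_disj by (auto simp: disjoint_family_on_def)
    qed (auto simp: cell_def divide_right_mono)
    then show ?thesis by (simp add: cell_measure)
  qed
  let ?F = "{..<N} \<rightarrow>\<^sub>E {..<K}"
  have "finite ?F" "card ?F = card {..<Q}" by (auto simp: card_PiE Q_def intro: finite_PiE)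
  \<comment> \<open>Any bijection serves as labelling, since all cells have the same length.\<close>
  then obtain e where e: "bij_betw e {..<Q} ?F"
    using finite_same_card_bij[of "{..<Q}" ?F] by auto
  \<comment> \<open>Indexing by sets of coordinates lets one count cover both the single sets and
    the pairwise intersections, as \<open>S {n} \<inter> S {k} = S {n, k}\<close>.\<close>
  define S where "S J = {c \<in> {..<Q}. \<forall>j\<in>J. e c j = 0}" for J
  have S_sub: "S J \<subseteq> {..<Q}" for J by (auto simp: S_def)
  have S_card: "real (card (S J)) / Q = 1 / K ^ card J" if "J \<subseteq> {..<N}" for J
  proof -
    have "e ` S J = {f \<in> ?F. \<forall>j\<in>J. f j = 0}"
      using e by (auto simp: S_def bij_betw_def)
    moreover have "inj_on e (S J)" using e S_sub by (auto simp: bij_betw_def intro: inj_on_subset)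
    ultimately have "card (S J) = card {f \<in> ?F. \<forall>j\<in>J. f j = 0}" using card_image by metis
    then have "card (S J) * K ^ card J = Q" using card_PiE_vanishing[OF that K] by (simp add: Q_def)
    then have "real Q = real (card (S J)) * real K ^ card J" by (metis of_nat_mult of_nat_power)
    moreover from this Q have "real (card (S J)) \<noteq> 0" by (metis less_irrefl mult_zero_left of_nat_eq_0_iff)
    ultimately show ?thesis by simp
  qed
  show thesis
  proof
    fix n assume n: "n < N"
    show "U (S {n}) \<in> sets borel" "U (S {n}) \<subseteq> {a..<a + 1}" using U_sets U_sub S_sub by auto
    show "measure lborel (U (S {n})) = 1 / K"
      using U_measure[OF S_sub] S_card[of "{n}"] n by simp
    fix k assume k: "k < N" "n \<noteq> k"
    have "S {n} \<inter> S {k} = S {n, k}" by (auto simp: S_def)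
    then show "measure lborel (U (S {n}) \<inter> U (S {k})) = 1 / K\<^sup>2"
      using U_measure[OF S_sub] S_card[of "{n, k}"] n k by (simp add: U_Int power2_eq_square)
  qed
qed

section \<open>Half-spiked targets and their distances\<close>

lemma prob_space_density_distribution:
  assumes "p \<in> distributions \<mu>"
  shows "prob_space (density \<mu> (\<lambda>x. ennreal (p x)))"
proof (rule prob_spaceI)
  have p [measurable]: "p \<in> borel_measurable \<mu>" using assms by (simp add: distributions_def)
  have "emeasure (density \<mu> (\<lambda>x. ennreal (p x))) (space \<mu>) = (\<integral>\<^sup>+x. ennreal (p x) \<partial>\<mu>)"
    by (auto simp: emeasure_density intro!: nn_integral_cong)
  then show "emeasure (density \<mu> (\<lambda>x. ennreal (p x))) (space (density \<mu> (\<lambda>x. ennreal (p x)))) = 1"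
    using assms by (simp add: distributions_def)
qed

lemma prob_space_iid: "p \<in> distributions \<mu> \<Longrightarrow> prob_space (iid \<mu> p m)"
  unfolding iid_def by (intro prob_space_PiM prob_space_density_distribution)

text \<open>When \<open>A\<close> has measure 1 and \<open>B\<close> has measure
  \<open>1 / K\<close>, each carries mass 1/2. Taking \<open>B\<close> to be the second unit-measure
  set and \<open>K = 1\<close> gives the uniform reference distribution, so targets and reference
  share one formula.\<close>

definition half_spiked :: "'a set \<Rightarrow> 'a set \<Rightarrow> real \<Rightarrow> 'a \<Rightarrow> real" where
  "half_spiked A B K x = (indicator A x + K * indicator B x) / 2"

text \<open>Each integrand is a step function. For the near distance, \<open>A\<close> contributes
  1/6 and \<open>B\<close> contributes 1/2. For the far distance, \<open>A\<close> contributes 1/2,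
  the rest of \<open>A'\<close> contributes \<open>1 - 1 / K\<close>, and the spike gives the
  remainder.\<close>

lemma
  fixes K :: real
  assumes sets [measurable]: "A \<in> sets \<mu>" "A' \<in> sets \<mu>" "B \<in> sets \<mu>"
    and disj: "A \<inter> A' = {}" and B: "B \<subseteq> A'"
    and m: "emeasure \<mu> A = 1" "emeasure \<mu> A' = 1" "measure \<mu> B = 1 / K" and K: "0 < K"
  shows half_spiked_distribution: "half_spiked A B K \<in> distributions \<mu>"
    and chi2_half_spiked_near: "chi2 \<mu> (half_spiked A B K) (indicator A) = 2 / 3"
    and chi2_half_spiked_far: "chi2 \<mu> (half_spiked A B K) (indicator A') = 2 - 4 / (K + 2)"
proof -
  have fin: "emeasure \<mu> B < \<infinity>"
    using emeasure_mono[OF B sets(2)] m by (simp add: less_top[symmetric] top_unique) (metis ennreal_one_neq_top top_unique)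
  have int: "integrable \<mu> (indicator A :: _ \<Rightarrow> real)" "integrable \<mu> (indicator A' :: _ \<Rightarrow> real)"
    "integrable \<mu> (indicator B :: _ \<Rightarrow> real)"
    using m fin by (auto intro!: integrable_real_indicator)
  have E: "(\<integral>x. indicator A x \<partial>\<mu>) = (1::real)" "(\<integral>x. indicator A' x \<partial>\<mu>) = (1::real)"
    "(\<integral>x. indicator B x \<partial>\<mu>) = 1 / K"
    using m sets by (auto simp: measure_def Int_absorb2 sets.sets_into_space)
  let ?p = "half_spiked A B K"
  have "(\<integral>\<^sup>+x. ennreal (?p x) \<partial>\<mu>) = ennreal (\<integral>x. ?p x \<partial>\<mu>)"
    unfolding half_spiked_def using int K by (intro nn_integral_eq_integral) auto
  also have "(\<integral>x. ?p x \<partial>\<mu>) = 1"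
    unfolding half_spiked_def using int E K by simp
  finally show "?p \<in> distributions \<mu>"
    using K by (simp add: distributions_def half_spiked_def[abs_def])
  have "(?p x - indicator A x)\<^sup>2 / (?p x + indicator A x) = indicator A x / 6 + K / 2 * indicator B x" for x
    using disj B K by (auto simp: half_spiked_def power2_eq_square split: split_indicator)
  then show "chi2 \<mu> ?p (indicator A) = 2 / 3"
    using int E K by (simp add: chi2_def)
  \<comment> \<open>As \<open>B\<close> lies inside \<open>A'\<close>, the coefficient of
    \<open>indicator B x\<close> is the value on \<open>B\<close> minus the 1 already supplied by
    \<open>indicator A' x\<close>.\<close>
  have "(?p x - indicator A' x)\<^sup>2 / (?p x + indicator A' x) =
      indicator A x / 2 + (K / 2 - 4 + 8 / (K + 2)) * indicator B x + indicator A' x" for x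
  proof -
    have "(K / 2 - 1)\<^sup>2 / (K / 2 + 1) = K / 2 - 4 + 8 / (K + 2) + 1"
      using K by (simp add: field_simps power2_eq_square)
    then show ?thesis
      using disj B K by (auto simp: half_spiked_def power2_eq_square split: split_indicator)
  qed
  moreover have "K / 2 - 4 + 8 / (K + 2) = K * (1 / 2 - 4 / (K + 2))"
    using K by (simp add: field_simps)
  then have half: "(K / 2 - 4 + 8 / (K + 2)) / K = 1 / 2 - 4 / (K + 2)"
    using K by simp
  ultimately have "chi2 \<mu> ?p (indicator A') = 1 / 2 + (K / 2 - 4 + 8 / (K + 2)) / K + 1"
    using int E K by (simp add: chi2_def)
  then show "chi2 \<mu> ?p (indicator A') = 2 - 4 / (K + 2)"
    by (simp add: half)
qed

text \<open>Against the uniform distribution on \<open>A \<union> A'\<close>, the target spiked on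
  \<open>B n\<close> has likelihood ratio 1 on \<open>A\<close>, \<open>K\<close> on
  \<open>B n\<close> and 0 on the rest of \<open>A'\<close>. Products of two such ratios have mean 1
  for distinct indices and \<open>(1 + K) / 2\<close>, at most \<open>K\<close>, for equal ones. By
  the bound on \<open>\<gamma>\<close> every such target satisfies the hypothesis under which
  \<open>\<phi>\<close>, the probability of a correct output, must be large.\<close>

lemma half_spiked_indistinguishable:
  fixes K N m :: nat and \<gamma> \<delta> \<epsilon> :: real
  assumes sets [measurable]: "A \<in> sets \<mu>" "A' \<in> sets \<mu>" and disj: "A \<inter> A' = {}"
    and m: "emeasure \<mu> A = 1" "emeasure \<mu> A' = 1" and K: "0 < K"
    and \<gamma>: "\<gamma> * (2 / 3) \<le> 2 - 4 / (real K + 2)"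
    and \<epsilon>: "0 < \<epsilon>" and N: "real K ^ m \<le> \<epsilon>\<^sup>2 * real N" "0 < N"
    and B: "\<And>n. n < N \<Longrightarrow> B n \<in> sets \<mu>" "\<And>n. n < N \<Longrightarrow> B n \<subseteq> A'"
      "\<And>n. n < N \<Longrightarrow> measure \<mu> (B n) = 1 / K"
      "\<And>n k. n < N \<Longrightarrow> k < N \<Longrightarrow> n \<noteq> k \<Longrightarrow> measure \<mu> (B n \<inter> B k) = 1 / K\<^sup>2"
    and \<phi>: "\<phi> \<in> borel_measurable (\<Pi>\<^sub>M i\<in>{..<m}. \<mu>)"
      "\<And>x. x \<in> space (\<Pi>\<^sub>M i\<in>{..<m}. \<mu>) \<Longrightarrow> 0 \<le> \<phi> x \<and> \<phi> x \<le> 1"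
    and test: "\<And>p. p \<in> distributions \<mu> \<Longrightarrow> \<gamma> * chi2 \<mu> p (indicator A) \<le> chi2 \<mu> p (indicator A') \<Longrightarrow>
      1 - \<delta> \<le> (\<integral>x. \<phi> x \<partial>iid \<mu> p m)"
  shows "1 - \<delta> - \<epsilon> \<le> (\<integral>x. \<phi> x \<partial>iid \<mu> (half_spiked A A' 1) m)"
proof -
  define g where "g = half_spiked A A' 1"
  define G where "G = density \<mu> (\<lambda>x. ennreal (g x))"
  \<comment> \<open>The intersection with \<open>A'\<close> is for indices beyond \<open>N\<close>,
    where \<open>B n\<close> is arbitrary: the bound of \<open>L n\<close> by \<open>K\<close> is
    required for every index.\<close>
  define L where "L n x = (indicator A x + real K * indicator (B n \<inter> A') x)" for n x
  have g [measurable]: "g \<in> borel_measurable \<mu>" unfolding g_def half_spiked_def by measurable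
  have L_meas: "L n \<in> borel_measurable \<mu>" if "n < N" for n
    unfolding L_def using B(1)[OF that] sets
    by (intro borel_measurable_add borel_measurable_times borel_measurable_indicator
        borel_measurable_const sets.Int)
  have g0: "0 \<le> g x" for x by (simp add: g_def half_spiked_def)
  have int_A: "integrable \<mu> (indicator A :: _ \<Rightarrow> real)" "(\<integral>x. indicator A x \<partial>\<mu>) = (1::real)"
    "integrable \<mu> (indicator A' :: _ \<Rightarrow> real)" "(\<integral>x. indicator A' x \<partial>\<mu>) = (1::real)"
    using m sets by (auto simp: measure_def Int_absorb2 sets.sets_into_space)
  have int_B: "integrable \<mu> (indicator (B n \<inter> B k) :: _ \<Rightarrow> real)"
    "(\<integral>x. indicator (B n \<inter> B k) x \<partial>\<mu>) = measure \<mu> (B n \<inter> B k)" if "n < N" "k < N" for n k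
  proof -
    have sets_B: "B n \<inter> B k \<in> sets \<mu>" using B(1) that by auto
    have "emeasure \<mu> (B n \<inter> B k) \<le> emeasure \<mu> A'"
      using B(2)[OF that(1)] sets by (intro emeasure_mono) auto
    then have "emeasure \<mu> (B n \<inter> B k) < \<infinity>" using m(2) by (simp add: order_le_less_trans)
    then show "integrable \<mu> (indicator (B n \<inter> B k) :: _ \<Rightarrow> real)" using sets_B by simp
    show "(\<integral>x. indicator (B n \<inter> B k) x \<partial>\<mu>) = measure \<mu> (B n \<inter> B k)"
      using sets_B by (simp add: Int_absorb2 sets.sets_into_space)
  qed
  have "g \<in> distributions \<mu>"
    unfolding g_def using m sets disj by (intro half_spiked_distribution[of A \<mu> A']) (auto simp: measure_def)
  then have G: "prob_space G"
    unfolding G_def by (rule prob_space_density_distribution)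
  have g_L: "g x * L n x = half_spiked A (B n) K x" if "n < N" for n x
    using B(2)[OF that] disj by (auto simp: g_def half_spiked_def L_def split: split_indicator)
  have iid_half_spiked: "(\<Pi>\<^sub>M i\<in>{..<m}. density G (\<lambda>x. ennreal (L n x))) = iid \<mu> (half_spiked A (B n) K) m"
    if "n < N" for n
  proof -
    have "density G (\<lambda>x. ennreal (L n x)) = density \<mu> (\<lambda>x. ennreal (half_spiked A (B n) K x))"
      unfolding G_def using L_meas[OF that]
      by (subst density_density_eq) (auto simp: ennreal_mult'[symmetric] g0 g_L[OF that])
    then show ?thesis by (simp add: iid_def)
  qed
  have E_L: "(\<integral>x. L n x \<partial>G) = 1" if n: "n < N" for n
  proof -
    have "(\<integral>x. L n x \<partial>G) = (\<integral>x. half_spiked A (B n) K x \<partial>\<mu>)"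
      unfolding G_def using L_meas[OF n] g0 by (simp add: integral_density g_L[OF n])
    also have "\<dots> = 1"
      unfolding half_spiked_def using int_A int_B[OF n n] B(3)[OF n] K by simp
    finally show ?thesis .
  qed
  have E_LL: "(\<integral>x. L n x * L k x \<partial>G) = (1 + real K ^ 2 * measure \<mu> (B n \<inter> B k)) / 2"
    if n: "n < N" and k: "k < N" for n k
  proof -
    have "g x * (L n x * L k x) = (indicator A x + real K ^ 2 * indicator (B n \<inter> B k) x) / 2" for x
      using B(2)[OF n] B(2)[OF k] disj
      by (auto simp: g_def half_spiked_def L_def power2_eq_square split: split_indicator)
    note g_LL = this
    have "(\<integral>x. L n x * L k x \<partial>G) = (\<integral>x. g x * (L n x * L k x) \<partial>\<mu>)"
      unfolding G_def using L_meas[OF n] L_meas[OF k] g0 by (simp add: integral_density)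
    also have "\<dots> = (\<integral>x. (indicator A x + real K ^ 2 * indicator (B n \<inter> B k) x) / 2 \<partial>\<mu>)"
      by (simp only: g_LL)
    also have "\<dots> = (1 + real K ^ 2 * measure \<mu> (B n \<inter> B k)) / 2"
      using int_A int_B[OF n k] by simp
    finally show ?thesis .
  qed
  have sets_G: "sets (\<Pi>\<^sub>M i\<in>{..<m}. G) = sets (\<Pi>\<^sub>M i\<in>{..<m}. \<mu>)"
    by (intro sets_PiM_cong) (auto simp: G_def)
  have "1 - \<delta> - \<epsilon> \<le> (\<integral>x. \<phi> x \<partial>(\<Pi>\<^sub>M i\<in>{..<m}. G))"
  proof (rule test_against_product_mixture[OF G _ _ _ _ _ _ _ _ \<epsilon> N])
    show "L n \<in> borel_measurable G" if "n < N" for n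
      using L_meas[OF that] by (simp add: G_def)
    show "0 \<le> L n x" "L n x \<le> K" for n x
      using K disj by (auto simp: L_def split: split_indicator)
    show "(\<integral>x. L n x \<partial>G) = 1" if "n < N" for n using E_L[OF that] .
    show "(\<integral>x. L n x * L k x \<partial>G) = 1" if "n < N" "k < N" "n \<noteq> k" for n k
      using E_LL[OF that(1,2)] B(4)[OF that] K by simp
    show "(\<integral>x. L n x * L n x \<partial>G) \<le> K" if "n < N" for n
      using E_LL[OF that that] B(3)[OF that] K by (simp add: power2_eq_square)
    show "\<phi> \<in> borel_measurable (\<Pi>\<^sub>M i\<in>{..<m}. G)"
      using \<phi>(1) measurable_cong_sets[OF sets_G refl] by blast
    show "0 \<le> \<phi> x \<and> \<phi> x \<le> 1" if "x \<in> space (\<Pi>\<^sub>M i\<in>{..<m}. G)" for x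
      using \<phi>(2) that sets_eq_imp_space_eq[OF sets_G] by blast
    show "1 - \<delta> \<le> (\<integral>x. \<phi> x \<partial>(\<Pi>\<^sub>M i\<in>{..<m}. density G (\<lambda>x. ennreal (L n x))))" if n: "n < N" for n
    proof -
      have K': "0 < real K" using K by simp
      note spiked = sets B(1)[OF n] disj B(2)[OF n] m B(3)[OF n] K'
      show ?thesis
        unfolding iid_half_spiked[OF n]
        by (rule test[OF half_spiked_distribution[OF spiked]])
          (simp only: chi2_half_spiked_near[OF spiked] chi2_half_spiked_far[OF spiked] \<gamma>)
    qed
  qed
  then show ?thesis by (simp add: iid_def G_def g_def)
qed

section \<open>The one-dimensional domain\<close>

definition real_line :: "(nat \<Rightarrow> real) measure" where
  "real_line = (\<Pi>\<^sub>M i\<in>{..<1}. lborel)"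

definition cylinder :: "real set \<Rightarrow> (nat \<Rightarrow> real) set" where
  "cylinder S = (\<lambda>x. x 0) -` S \<inter> space real_line"

text \<open>Evaluation at 0 maps the one-factor product measure to \<open>lborel\<close>, so Borel
  sets of reals and their measures carry over to the domain.\<close>

lemma
  assumes S: "S \<in> sets borel"
  shows sets_cylinder: "cylinder S \<in> sets real_line"
    and emeasure_cylinder: "emeasure real_line (cylinder S) = emeasure lborel S"
proof -
  interpret product_sigma_finite "\<lambda>i::nat. lborel :: real measure" by standard
  have one: "{..<1::nat} = {0}" by auto
  have proj [measurable]: "(\<lambda>x. x 0) \<in> measurable real_line lborel"
    unfolding real_line_def by (rule measurable_component_singleton) simp
  show "cylinder S \<in> sets real_line"
    unfolding cylinder_def using S by measurable
  have "emeasure (distr real_line lborel (\<lambda>x. x 0)) S = emeasure lborel S"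
    unfolding real_line_def one using distr_singleton[of 0] by simp
  then show "emeasure real_line (cylinder S) = emeasure lborel S"
    using S proj by (simp add: emeasure_distr cylinder_def)
qed

section \<open>Failure of every test\<close>

theorem theorem3:
  fixes \<gamma> :: real
  assumes "1 < \<gamma>" and "\<gamma> < 3"
  shows "\<exists>\<mu> p0 p1. is_domain \<mu> \<and> p0 \<in> distributions \<mu> \<and> p1 \<in> distributions \<mu> \<and>
           \<not> same_distribution \<mu> p0 p1 \<and> \<not> robustly_testable \<mu> \<gamma> p0 p1"
proof (intro exI conjI)
  let ?I = "\<lambda>a. cylinder {a..<a + 1::real}"
  have sets: "?I a \<in> sets real_line" for a by (simp add: sets_cylinder)
  have em: "emeasure real_line (?I a) = 1" for a by (simp add: emeasure_cylinder)
  have disj: "?I 0 \<inter> ?I 1 = {}" by (auto simp: cylinder_def)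
  show "is_domain real_line" unfolding is_domain_def real_line_def by blast
  have dist: "indicator (?I a) \<in> distributions real_line" for a
    using sets[of a] em[of a] by (simp add: distributions_def ennreal_indicator)
  show "indicator (?I 0) \<in> distributions real_line" "indicator (?I 1) \<in> distributions real_line"
    by (rule dist)+
  show "\<not> same_distribution real_line (indicator (?I 0)) (indicator (?I 1))"
  proof
    assume "same_distribution real_line (indicator (?I 0)) (indicator (?I 1))"
    \<comment> \<open>On \<open>?I 0\<close> the two indicators are 1 and 0, so agreement almost
      everywhere would make this set of measure 1 null.\<close>
    then have "AE x in real_line. x \<notin> ?I 0"
      unfolding same_distribution_def using disj
      by (rule_tac AE_mp) (auto split: split_indicator_asm)
    then have "?I 0 \<in> null_sets real_line" using sets[of 0] by (simp add: AE_iff_null_sets)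
    with em[of 0] show False by auto
  qed
  show "\<not> robustly_testable real_line \<gamma> (indicator (?I 0)) (indicator (?I 1))"
  proof
    assume "robustly_testable real_line \<gamma> (indicator (?I 0)) (indicator (?I 1))"
    then obtain T where T: "is_test real_line T"
      and Tm: "\<And>\<delta>. 0 < \<delta> \<Longrightarrow> \<exists>m0\<ge>1. \<forall>p\<in>distributions real_line. \<forall>m\<ge>m0.
          (\<gamma> * chi2 real_line p (indicator (?I 0)) \<le> chi2 real_line p (indicator (?I 1)) \<longrightarrow>
             (\<integral>xs. 1 - T m xs \<partial>iid real_line p m) \<ge> 1 - \<delta>) \<and>
          (chi2 real_line p (indicator (?I 0)) \<ge> \<gamma> * chi2 real_line p (indicator (?I 1)) \<longrightarrow>
             (\<integral>xs. T m xs \<partial>iid real_line p m) \<ge> 1 - \<delta>)"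
      unfolding robustly_testable_def by blast
    \<comment> \<open>Error 1/8 here and mixture loss 1/8 below leave at least 3/4 for each output
      under the same law, and these cannot both hold.\<close>
    have "0 < (1 / 8 :: real)" by simp
    from Tm[OF this] obtain m where m: "1 \<le> m"
      and H0: "\<And>p. p \<in> distributions real_line \<Longrightarrow>
          \<gamma> * chi2 real_line p (indicator (?I 0)) \<le> chi2 real_line p (indicator (?I 1)) \<Longrightarrow>
          1 - 1 / 8 \<le> (\<integral>xs. 1 - T m xs \<partial>iid real_line p m)"
      and H1: "\<And>p. p \<in> distributions real_line \<Longrightarrow>
          \<gamma> * chi2 real_line p (indicator (?I 1)) \<le> chi2 real_line p (indicator (?I 0)) \<Longrightarrow>
          1 - 1 / 8 \<le> (\<integral>xs. T m xs \<partial>iid real_line p m)"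
      by (blast intro: order_refl)
    have Tmeas: "T m \<in> borel_measurable (\<Pi>\<^sub>M i\<in>{..<m}. real_line)"
      and Tbd: "\<And>x. x \<in> space (\<Pi>\<^sub>M i\<in>{..<m}. real_line) \<Longrightarrow> 0 \<le> T m x \<and> T m x \<le> 1"
      using T m by (auto simp: is_test_def)
    \<comment> \<open>The distance ratio reaches \<open>\<gamma>\<close> as soon as
      \<open>K + 2\<close> is at least \<open>6 / (3 - \<gamma>)\<close>; this is where
      \<open>\<gamma> < 3\<close> enters.\<close>
    obtain K where K: "6 / (3 - \<gamma>) < real K" using reals_Archimedean2 by blast
    with \<open>\<gamma> < 3\<close> have K0: "0 < K" by (metis divide_pos_pos diff_gt_0_iff_gt less_trans of_nat_0_less_iff zero_less_numeral)
    from K \<open>\<gamma> < 3\<close> have "6 < real K * (3 - \<gamma>)" by (simp add: field_simps)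
    then have \<gamma>: "\<gamma> * (2 / 3) \<le> 2 - 4 / (real K + 2)"
      using \<open>\<gamma> < 3\<close> by (simp add: field_simps)
    \<comment> \<open>The number of candidate spikes is chosen after the sample size
      \<open>m\<close>, which is possible because \<open>m\<close> is uniform over all targets. The
      factor 64 is the inverse square of the loss 1/8.\<close>
    obtain N where "64 * real K ^ m < real N" using reals_Archimedean2 by blast
    then have N: "real K ^ m \<le> (1 / 8)\<^sup>2 * real N" by (simp add: power2_eq_square)
    moreover have "0 < real K ^ m" using K0 by simp
    ultimately have N0: "0 < N" by (cases N) auto
    have split: "\<exists>B. (\<forall>n<N. B n \<in> sets real_line \<and> B n \<subseteq> ?I a \<and> measure real_line (B n) = 1 / K \<and>
        (\<forall>k<N. n \<noteq> k \<longrightarrow> measure real_line (B n \<inter> B k) = 1 / K\<^sup>2))" for a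
    proof -
      obtain C where C: "\<And>n. n < N \<Longrightarrow> C n \<in> sets borel" "\<And>n. n < N \<Longrightarrow> C n \<subseteq> {a..<a + 1}"
        "\<And>n. n < N \<Longrightarrow> measure lborel (C n) = 1 / K"
        "\<And>n k. n < N \<Longrightarrow> k < N \<Longrightarrow> n \<noteq> k \<Longrightarrow> measure lborel (C n \<inter> C k) = 1 / K\<^sup>2"
        using pairwise_independent_subsets_unit_interval[OF K0, of N a] by blast
      have Int: "cylinder S \<inter> cylinder S' = cylinder (S \<inter> S')" for S S'
        by (auto simp: cylinder_def)
      have mono: "cylinder S \<subseteq> cylinder S'" if "S \<subseteq> S'" for S S'
        using that by (auto simp: cylinder_def)
      have meas: "measure real_line (cylinder S) = measure lborel S" if "S \<in> sets borel" for S
        using that by (simp add: measure_def emeasure_cylinder)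
      show ?thesis
        using C mono by (intro exI[of _ "\<lambda>n. cylinder (C n)"]) (simp add: Int meas sets_cylinder)
    qed
    obtain B where B: "\<forall>n<N. B n \<in> sets real_line \<and> B n \<subseteq> ?I 1 \<and> measure real_line (B n) = 1 / K \<and>
        (\<forall>k<N. n \<noteq> k \<longrightarrow> measure real_line (B n \<inter> B k) = 1 / K\<^sup>2)"
      using split by blast
    obtain B' where B': "\<forall>n<N. B' n \<in> sets real_line \<and> B' n \<subseteq> ?I 0 \<and> measure real_line (B' n) = 1 / K \<and>
        (\<forall>k<N. n \<noteq> k \<longrightarrow> measure real_line (B' n \<inter> B' k) = 1 / K\<^sup>2)"
      using split by blast
    let ?G = "iid real_line (half_spiked (?I 0) (?I 1) 1) m"
    have T0: "1 - 1 / 8 - 1 / 8 \<le> (\<integral>x. 1 - T m x \<partial>?G)"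
      by (rule half_spiked_indistinguishable[OF sets sets disj em em K0 \<gamma> _ N N0, of B])
         (use B Tmeas Tbd H0 in auto)
    have disj': "?I 1 \<inter> ?I 0 = {}" using disj by blast
    \<comment> \<open>The reference is symmetric in the two intervals, so both applications bound
      means under the same law.\<close>
    have swap: "half_spiked (?I 0) (?I 1) 1 = half_spiked (?I 1) (?I 0) 1"
      by (simp add: half_spiked_def fun_eq_iff add.commute)
    have T1: "1 - 1 / 8 - 1 / 8 \<le> (\<integral>x. T m x \<partial>?G)"
      unfolding swap
      by (rule half_spiked_indistinguishable[OF sets sets disj' em em K0 \<gamma> _ N N0, of B'])
         (use B' Tmeas Tbd H1 in auto)
    have "half_spiked (?I 0) (?I 1) 1 \<in> distributions real_line"
    proof (rule half_spiked_distribution[OF sets sets sets disj subset_refl em em])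
      show "measure real_line (?I 1) = 1 / 1" by (simp only: measure_def em) simp
    qed simp
    then interpret prob_space ?G by (rule prob_space_iid)
    \<comment> \<open>A non-integrable function has integral 0 by default, which the lower bound
      \<open>T1\<close> excludes.\<close>
    have "integrable ?G (T m)"
    proof (rule ccontr)
      assume "\<not> integrable ?G (T m)"
      then have "(\<integral>x. T m x \<partial>?G) = 0" by (rule not_integrable_integral_eq)
      with T1 show False by simp
    qed
    then have "(\<integral>x. 1 - T m x \<partial>?G) = 1 - (\<integral>x. T m x \<partial>?G)"
      using Bochner_Integration.integral_diff[OF integrable_const[of 1], of "T m"] prob_space by simp
    with T0 T1 show False by simp
  qed
qed

end
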